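(* Let $(E_1,\mathcal{E}_1)$ and $(E_2,\mathcal{E}_2)$ be measurable spaces, and let $(X_n),(X_n')$ be sequences of random elements of $E_1$ and $(Y_n),(Y_n')$ sequences of random elements of $E_2$, all defined on one probability space $(\Omega,\mathcal{F},\mathbb{P})$, such that $\{X_n\ne X_n'\}$ and $\{Y_n\neq Y_n'\}$ are events for all $n$. Suppose that: 1) $X_n'$ and $Y_n'$ are independent for all $n$; 2) $\mathbb{P}\{X_n\neq X_n'\}\to 0$ and $\mathbb{P}\{Y_n\neq Y_n'\}\to 0$ as $n\to+\infty$. Then condition AI-4 holds for $(X_n)$ and $(Y_n)$.
   Context: $P_\xi$ denotes the distribution of a random element $\xi$; $(X_n,Y_n)$ is regarded as a random element of $(E_1\times E_2,\mathcal{E}_1\times\mathcal{E}_2)$. AI-4: $\|P_{(X_n,Y_n)}-P_{X_n}\times P_{Y_n}\|_{var}\to 0$ as $n\to+\infty$, where $\|\cdot\|_{var}$ is the total variation norm of signed measures. *)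

theory Defs
  imports "HOL-Probability.Probability"
begin

text \<open>The total variation norm of a signed measure is its total variation on the whole space,
  i.e. the supremum over finite measurable partitions (so the difference of two probability
  measures has norm at most 2). A finite signed measure on the sigma-algebra of \<open>M\<close>
  is represented by its set function \<open>\<nu>\<close>; of \<open>M\<close> only the
  measurable-space structure is used.\<close>

definition tv_norm :: "'a measure \<Rightarrow> ('a set \<Rightarrow> real) \<Rightarrow> ennreal" where
  "tv_norm M \<nu> =
    (SUP \<P> \<in> {\<P>. finite \<P> \<and> \<P> \<subseteq> sets M \<and> partition_on (space M) \<P>}. ennreal (\<Sum>A\<in>\<P>. \<bar>\<nu> A\<bar>))"

text \<open>The library's \<open>indep_var\<close> forces both random elements to take values in the same
  type. This is its definition for two different value types.\<close>

definition (in prob_space) indep_elements ::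
  "'b measure \<Rightarrow> ('a \<Rightarrow> 'b) \<Rightarrow> 'c measure \<Rightarrow> ('a \<Rightarrow> 'c) \<Rightarrow> bool" where
  "indep_elements E\<^sub>1 X E\<^sub>2 Y \<longleftrightarrow>
    random_variable E\<^sub>1 X \<and> random_variable E\<^sub>2 Y \<and>
    indep_set {X -` A \<inter> space M | A. A \<in> sets E\<^sub>1} {Y -` B \<inter> space M | B. B \<in> sets E\<^sub>2}"

definition AI_4 ::
  "'a measure \<Rightarrow> 'b measure \<Rightarrow> 'c measure \<Rightarrow> (nat \<Rightarrow> 'a \<Rightarrow> 'b) \<Rightarrow> (nat \<Rightarrow> 'a \<Rightarrow> 'c) \<Rightarrow> bool" where
  "AI_4 M E\<^sub>1 E\<^sub>2 X Y \<longleftrightarrow>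
    (\<lambda>n. tv_norm (E\<^sub>1 \<Otimes>\<^sub>M E\<^sub>2)
      (\<lambda>C. measure (distr M (E\<^sub>1 \<Otimes>\<^sub>M E\<^sub>2) (\<lambda>\<omega>. (X n \<omega>, Y n \<omega>))) C
          - measure (distr M E\<^sub>1 (X n) \<Otimes>\<^sub>M distr M E\<^sub>2 (Y n)) C)) \<longlonglongrightarrow> 0"

end

theory Submission
  imports Defs
begin

text \<open>If two random elements \<open>Z\<close>, \<open>Z'\<close> differ only on an event of probability \<open>\<epsilon>\<close>, then their laws
  differ by at most \<open>\<epsilon>\<close> on every measurable set. With
  \<open>\<epsilon>\<^sub>n = P(X\<^sub>n \<noteq> X'\<^sub>n) + P(Y\<^sub>n \<noteq> Y'\<^sub>n)\<close>, this coupling bound (\<open>coupling_bound\<close>) applies twice.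
  On \<open>M\<close>, it compares the joint law of \<open>(X\<^sub>n, Y\<^sub>n)\<close> with that of \<open>(X'\<^sub>n, Y'\<^sub>n)\<close>. On the product
  \<open>M \<Otimes>\<^sub>M M\<close>, where \<open>(\<omega>\<^sub>1, \<omega>\<^sub>2) \<mapsto> (X\<^sub>n \<omega>\<^sub>1, Y\<^sub>n \<omega>\<^sub>2)\<close> has as its law the product of the marginal laws,
  it compares the product of the laws of \<open>X\<^sub>n\<close> and \<open>Y\<^sub>n\<close> with that of \<open>X'\<^sub>n\<close> and \<open>Y'\<^sub>n\<close>.
  By independence the two primed laws coincide (\<open>distr_pair_eq_if_indep_elements\<close>), so the signed
  measure in question is bounded by \<open>2 \<epsilon>\<^sub>n\<close> on every measurable set. Collecting the
  cells of a partition according to the sign of that signed measure turns this into the bound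
  \<open>4 \<epsilon>\<^sub>n\<close> for its total variation norm (\<open>tv_norm_diff_le\<close>), and \<open>\<epsilon>\<^sub>n \<longlonglongrightarrow> 0\<close>.\<close>

lemma tv_norm_diff_le:
  assumes "finite_measure P" "finite_measure Q"
    and sets: "sets P = sets N" "sets Q = sets N"
    and bound: "\<And>C. C \<in> sets N \<Longrightarrow> \<bar>measure P C - measure Q C\<bar> \<le> e"
  shows "tv_norm N (\<lambda>C. measure P C - measure Q C) \<le> ennreal (2 * e)"
  unfolding tv_norm_def
proof (rule SUP_least)
  interpret P: finite_measure P by fact
  interpret Q: finite_measure Q by fact
  fix \<P> assume "\<P> \<in> {\<P>. finite \<P> \<and> \<P> \<subseteq> sets N \<and> partition_on (space N) \<P>}"
  then have fin: "finite \<P>" and sub: "\<P> \<subseteq> sets N" and part: "partition_on (space N) \<P>"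
    by auto
  define \<nu> where "\<nu> = (\<lambda>C. measure P C - measure Q C)"
  \<comment> \<open>By additivity, such a sum is the value of \<open>\<nu>\<close> on a single measurable set.\<close>
  have sum_bound: "\<bar>\<Sum>A\<in>\<A>. \<nu> A\<bar> \<le> e" if "\<A> \<subseteq> \<P>" for \<A>
  proof -
    have disj: "disjoint_family_on (\<lambda>A. A) \<A>"
      using partition_onD2[OF part] that by (auto simp: disjoint_family_on_def disjoint_def)
    have fin': "finite \<A>" and meas: "\<A> \<subseteq> sets N"
      using fin sub that finite_subset by auto
    have "(\<Sum>A\<in>\<A>. \<nu> A) = \<nu> (\<Union>\<A>)"
      using P.finite_measure_finite_Union[OF fin' _ disj] Q.finite_measure_finite_Union[OF fin' _ disj] meas
      by (simp add: \<nu>_def sum_subtractf sets)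
    moreover have "\<Union>\<A> \<in> sets N"
      using fin' meas by (intro sets.finite_Union) auto
    ultimately show ?thesis
      using bound by (simp add: \<nu>_def)
  qed
  have "(\<Sum>A\<in>\<P>. \<bar>\<nu> A\<bar>) = (\<Sum>A\<in>{A\<in>\<P>. 0 \<le> \<nu> A}. \<bar>\<nu> A\<bar>) + (\<Sum>A\<in>{A\<in>\<P>. \<not> 0 \<le> \<nu> A}. \<bar>\<nu> A\<bar>)"
    using fin by (subst sum.union_disjoint[symmetric]) (auto intro!: sum.cong)
  also have "\<dots> = (\<Sum>A\<in>{A\<in>\<P>. 0 \<le> \<nu> A}. \<nu> A) - (\<Sum>A\<in>{A\<in>\<P>. \<not> 0 \<le> \<nu> A}. \<nu> A)"
    by (simp add: sum_negf)
  also have "\<dots> \<le> 2 * e"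
    using sum_bound[of "{A\<in>\<P>. 0 \<le> \<nu> A}"] sum_bound[of "{A\<in>\<P>. \<not> 0 \<le> \<nu> A}"] by auto
  finally show "ennreal (\<Sum>A\<in>\<P>. \<bar>measure P A - measure Q A\<bar>) \<le> ennreal (2 * e)"
    unfolding \<nu>_def by (rule ennreal_leI)
qed

context prob_space
begin

lemma coupling_bound:
  assumes Z: "Z \<in> measurable M N" and Z': "Z' \<in> measurable M N"
    and D: "D \<in> sets M" and eq: "\<And>\<omega>. \<omega> \<in> space M - D \<Longrightarrow> Z \<omega> = Z' \<omega>"
    and C: "C \<in> sets N"
  shows "\<bar>measure (distr M N Z) C - measure (distr M N Z') C\<bar> \<le> prob D"
proof -
  have le: "prob (U -` C \<inter> space M) \<le> prob (V -` C \<inter> space M) + prob D"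
    if "U \<in> measurable M N" "V \<in> measurable M N" "\<And>\<omega>. \<omega> \<in> space M - D \<Longrightarrow> U \<omega> = V \<omega>" for U V
  proof -
    have "prob (U -` C \<inter> space M) \<le> prob ((V -` C \<inter> space M) \<union> D)"
      using that D C by (intro finite_measure_mono) (auto intro: measurable_sets)
    also have "\<dots> \<le> prob (V -` C \<inter> space M) + prob D"
      using that D C by (intro measure_Un_le) (auto intro: measurable_sets)
    finally show ?thesis .
  qed
  show ?thesis
    using le[OF Z Z' eq] le[OF Z' Z eq[symmetric]] Z Z' C by (simp add: measure_distr abs_le_iff)
qed

lemma distr_pair_eq_if_indep_elements:
  assumes "indep_elements E\<^sub>1 X E\<^sub>2 Y"
  shows "distr M (E\<^sub>1 \<Otimes>\<^sub>M E\<^sub>2) (\<lambda>\<omega>. (X \<omega>, Y \<omega>)) = distr M E\<^sub>1 X \<Otimes>\<^sub>M distr M E\<^sub>2 Y"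
proof (rule pair_measure_eqI[symmetric])
  have [measurable]: "X \<in> measurable M E\<^sub>1" "Y \<in> measurable M E\<^sub>2"
    and ind: "indep_set {X -` A \<inter> space M | A. A \<in> sets E\<^sub>1} {Y -` B \<inter> space M | B. B \<in> sets E\<^sub>2}"
    using assms by (auto simp: indep_elements_def)
  show "sigma_finite_measure (distr M E\<^sub>1 X)" "sigma_finite_measure (distr M E\<^sub>2 Y)"
    by (auto intro!: prob_space_imp_sigma_finite prob_space_distr)
  show "sets (distr M E\<^sub>1 X \<Otimes>\<^sub>M distr M E\<^sub>2 Y) = sets (distr M (E\<^sub>1 \<Otimes>\<^sub>M E\<^sub>2) (\<lambda>\<omega>. (X \<omega>, Y \<omega>)))"
    by (simp cong: sets_pair_measure_cong)
  fix A B assume "A \<in> sets (distr M E\<^sub>1 X)" "B \<in> sets (distr M E\<^sub>2 Y)"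
  then have [measurable]: "A \<in> sets E\<^sub>1" "B \<in> sets E\<^sub>2"
    by auto
  have vim: "(\<lambda>\<omega>. (X \<omega>, Y \<omega>)) -` (A \<times> B) \<inter> space M = (X -` A \<inter> space M) \<inter> (Y -` B \<inter> space M)"
    by auto
  have "prob ((X -` A \<inter> space M) \<inter> (Y -` B \<inter> space M)) = prob (X -` A \<inter> space M) * prob (Y -` B \<inter> space M)"
    by (rule indep_setD[OF ind]) auto
  then show "emeasure (distr M E\<^sub>1 X) A * emeasure (distr M E\<^sub>2 Y) B
      = emeasure (distr M (E\<^sub>1 \<Otimes>\<^sub>M E\<^sub>2) (\<lambda>\<omega>. (X \<omega>, Y \<omega>))) (A \<times> B)"
    by (simp add: emeasure_distr vim emeasure_eq_measure ennreal_mult'')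
qed

text \<open>The product of the marginal laws is the law of \<open>(\<omega>\<^sub>1, \<omega>\<^sub>2) \<mapsto> (X \<omega>\<^sub>1, Y \<omega>\<^sub>2)\<close> on \<open>M \<Otimes>\<^sub>M M\<close>, hence
  \<open>coupling_bound\<close> on that space applies.\<close>

lemma product_coupling_bound:
  assumes [measurable]: "X \<in> measurable M E\<^sub>1" "X' \<in> measurable M E\<^sub>1"
      "Y \<in> measurable M E\<^sub>2" "Y' \<in> measurable M E\<^sub>2"
    and D [measurable]: "D\<^sub>1 \<in> sets M" "D\<^sub>2 \<in> sets M"
    and eq: "\<And>\<omega>. \<omega> \<in> space M - D\<^sub>1 \<Longrightarrow> X \<omega> = X' \<omega>" "\<And>\<omega>. \<omega> \<in> space M - D\<^sub>2 \<Longrightarrow> Y \<omega> = Y' \<omega>"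
    and C: "C \<in> sets (E\<^sub>1 \<Otimes>\<^sub>M E\<^sub>2)"
  shows "\<bar>measure (distr M E\<^sub>1 X \<Otimes>\<^sub>M distr M E\<^sub>2 Y) C - measure (distr M E\<^sub>1 X' \<Otimes>\<^sub>M distr M E\<^sub>2 Y') C\<bar>
    \<le> prob D\<^sub>1 + prob D\<^sub>2"
proof -
  interpret MM: pair_prob_space M M ..
  have law: "distr M E\<^sub>1 U \<Otimes>\<^sub>M distr M E\<^sub>2 V
      = distr (M \<Otimes>\<^sub>M M) (E\<^sub>1 \<Otimes>\<^sub>M E\<^sub>2) (\<lambda>(\<omega>\<^sub>1, \<omega>\<^sub>2). (U \<omega>\<^sub>1, V \<omega>\<^sub>2))"
    if "U \<in> measurable M E\<^sub>1" "V \<in> measurable M E\<^sub>2" for U V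
    using that by (intro pair_measure_distr prob_space_imp_sigma_finite prob_space_distr)
  have "\<bar>measure (distr M E\<^sub>1 X \<Otimes>\<^sub>M distr M E\<^sub>2 Y) C - measure (distr M E\<^sub>1 X' \<Otimes>\<^sub>M distr M E\<^sub>2 Y') C\<bar>
      \<le> MM.prob (D\<^sub>1 \<times> space M \<union> space M \<times> D\<^sub>2)"
    using C by (subst (1 2) law) (auto intro!: MM.coupling_bound eq simp: space_pair_measure)
  also have "\<dots> \<le> MM.prob (D\<^sub>1 \<times> space M) + MM.prob (space M \<times> D\<^sub>2)"
    by (intro measure_Un_le) auto
  also have "\<dots> = prob D\<^sub>1 + prob D\<^sub>2"
    by (simp add: measure_def emeasure_pair_measure_Times emeasure_space_1 D)
  finally show ?thesis .
qed

lemma tv_norm_joint_minus_product_le: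
  assumes [measurable]: "X \<in> measurable M E\<^sub>1" "X' \<in> measurable M E\<^sub>1"
      "Y \<in> measurable M E\<^sub>2" "Y' \<in> measurable M E\<^sub>2"
    and D [measurable]: "{\<omega> \<in> space M. X \<omega> \<noteq> X' \<omega>} \<in> sets M" "{\<omega> \<in> space M. Y \<omega> \<noteq> Y' \<omega>} \<in> sets M"
    and ind: "indep_elements E\<^sub>1 X' E\<^sub>2 Y'"
  shows "tv_norm (E\<^sub>1 \<Otimes>\<^sub>M E\<^sub>2) (\<lambda>C. measure (distr M (E\<^sub>1 \<Otimes>\<^sub>M E\<^sub>2) (\<lambda>\<omega>. (X \<omega>, Y \<omega>))) C
      - measure (distr M E\<^sub>1 X \<Otimes>\<^sub>M distr M E\<^sub>2 Y) C)
    \<le> ennreal (4 * (prob {\<omega> \<in> space M. X \<omega> \<noteq> X' \<omega>} + prob {\<omega> \<in> space M. Y \<omega> \<noteq> Y' \<omega>}))"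
    (is "tv_norm _ (\<lambda>C. measure ?J C - measure ?Q C) \<le> ennreal (4 * (prob ?D\<^sub>1 + prob ?D\<^sub>2))")
proof -
  let ?J' = "distr M (E\<^sub>1 \<Otimes>\<^sub>M E\<^sub>2) (\<lambda>\<omega>. (X' \<omega>, Y' \<omega>))"
  let ?Q' = "distr M E\<^sub>1 X' \<Otimes>\<^sub>M distr M E\<^sub>2 Y'"
  interpret PX: prob_space "distr M E\<^sub>1 X" by (rule prob_space_distr) simp
  interpret PY: prob_space "distr M E\<^sub>2 Y" by (rule prob_space_distr) simp
  interpret Q: pair_prob_space "distr M E\<^sub>1 X" "distr M E\<^sub>2 Y" ..
  interpret J: prob_space ?J by (rule prob_space_distr) simp
  have "\<bar>measure ?J C - measure ?Q C\<bar> \<le> 2 * (prob ?D\<^sub>1 + prob ?D\<^sub>2)"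
    if C: "C \<in> sets (E\<^sub>1 \<Otimes>\<^sub>M E\<^sub>2)" for C
  proof -
    have "\<bar>measure ?J C - measure ?J' C\<bar> \<le> prob (?D\<^sub>1 \<union> ?D\<^sub>2)"
      using C D by (intro coupling_bound) auto
    moreover have "prob (?D\<^sub>1 \<union> ?D\<^sub>2) \<le> prob ?D\<^sub>1 + prob ?D\<^sub>2"
      using D by (intro measure_Un_le)
    moreover have "\<bar>measure ?Q C - measure ?Q' C\<bar> \<le> prob ?D\<^sub>1 + prob ?D\<^sub>2"
      using C D by (intro product_coupling_bound) auto
    moreover have "?J' = ?Q'"
      by (rule distr_pair_eq_if_indep_elements[OF ind])
    ultimately show ?thesis by simp
  qed
  then have "tv_norm (E\<^sub>1 \<Otimes>\<^sub>M E\<^sub>2) (\<lambda>C. measure ?J C - measure ?Q C)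
      \<le> ennreal (2 * (2 * (prob ?D\<^sub>1 + prob ?D\<^sub>2)))"
    by (intro tv_norm_diff_le J.finite_measure_axioms Q.finite_measure_axioms)
      (simp_all cong: sets_pair_measure_cong)
  then show ?thesis by simp
qed

end

theorem proposition3:
  fixes M :: "'a measure" and E\<^sub>1 :: "'b measure" and E\<^sub>2 :: "'c measure"
    and X X' :: "nat \<Rightarrow> 'a \<Rightarrow> 'b" and Y Y' :: "nat \<Rightarrow> 'a \<Rightarrow> 'c"
  assumes "prob_space M"
    and "\<And>n. X n \<in> measurable M E\<^sub>1" and "\<And>n. X' n \<in> measurable M E\<^sub>1"
    and "\<And>n. Y n \<in> measurable M E\<^sub>2" and "\<And>n. Y' n \<in> measurable M E\<^sub>2"
    and "\<And>n. {\<omega> \<in> space M. X n \<omega> \<noteq> X' n \<omega>} \<in> sets M"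
    and "\<And>n. {\<omega> \<in> space M. Y n \<omega> \<noteq> Y' n \<omega>} \<in> sets M"
    and "\<And>n. prob_space.indep_elements M E\<^sub>1 (X' n) E\<^sub>2 (Y' n)"
    and "(\<lambda>n. measure M {\<omega> \<in> space M. X n \<omega> \<noteq> X' n \<omega>}) \<longlonglongrightarrow> 0"
    and "(\<lambda>n. measure M {\<omega> \<in> space M. Y n \<omega> \<noteq> Y' n \<omega>}) \<longlonglongrightarrow> 0"
  shows "AI_4 M E\<^sub>1 E\<^sub>2 X Y"
proof -
  interpret prob_space M by fact
  let ?e = "\<lambda>n. 4 * (prob {\<omega> \<in> space M. X n \<omega> \<noteq> X' n \<omega>} + prob {\<omega> \<in> space M. Y n \<omega> \<noteq> Y' n \<omega>})"
  have "?e \<longlonglongrightarrow> 4 * (0 + 0)"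
    using assms(9,10) by (intro tendsto_intros)
  then have "(\<lambda>n. ennreal (?e n)) \<longlonglongrightarrow> 0"
    by (intro tendsto_ennrealI[where x = 0, simplified]) simp
  moreover have "tv_norm (E\<^sub>1 \<Otimes>\<^sub>M E\<^sub>2) (\<lambda>C. measure (distr M (E\<^sub>1 \<Otimes>\<^sub>M E\<^sub>2) (\<lambda>\<omega>. (X n \<omega>, Y n \<omega>))) C
      - measure (distr M E\<^sub>1 (X n) \<Otimes>\<^sub>M distr M E\<^sub>2 (Y n)) C) \<le> ennreal (?e n)" for n
    by (rule tv_norm_joint_minus_product_le) (rule assms)+
  ultimately show ?thesis
    unfolding AI_4_def
    by - (rule tendsto_sandwich[OF _ _ tendsto_const], auto)
qed

end
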